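(* For every positive integer $n$, let $L_n(x)$ be the $n$-th Laguerre polynomial. Then $$\int_{0}^{\infty} \left[ \frac{L_{n}(x) - L_{n}(0)}{x} \right]^{2} e^{-x} \, dx = 2n - H_{n},$$ where $H_{n} = 1 + \tfrac{1}{2} + \cdots + \tfrac{1}{n}$ is the $n$-th harmonic number.
   Context: The Laguerre polynomials are $L_n(x)=\sum_{k=0}^{n}\frac{(-1)^k}{k!}\binom{n}{k}x^k$. *)

theory Defs
  imports "HOL-Analysis.Analysis"
begin

definition laguerre :: "nat \<Rightarrow> real \<Rightarrow> real" where
  "laguerre n x = (\<Sum>k=0..n. (-1) ^ k / fact k * real (n choose k) * x ^ k)"

end

theory Submission
  imports Defs "HOL-Computational_Algebra.Polynomial"
begin

text \<open>
  Write \<open>E p\<close> for the integral of \<open>p(x) exp (- x)\<close> over the positive half-line. The Laguerre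
  polynomials are orthonormal for the inner product \<open>E (p * q)\<close>, so the integral in question is
  the sum of the squares of the coordinates of \<open>(L\<^sub>n - 1) / x\<close> in the basis \<open>L\<^sub>0, L\<^sub>1, \<dots>\<close>.

  The proof uses two relations between neighbours, both read off from the coefficients:
  \<open>(L\<^sub>n\<^sub>+\<^sub>1 - L\<^sub>n)' = - L\<^sub>n\<close> and \<open>(n + 1) (L\<^sub>n\<^sub>+\<^sub>1 - L\<^sub>n) = x L\<^sub>n\<^sub>+\<^sub>1'\<close>.
  Summing the first gives \<open>L\<^sub>n' = - (L\<^sub>0 + \<dots> + L\<^sub>n\<^sub>-\<^sub>1)\<close>; inserting this into the second and
  summing again yields \<open>(L\<^sub>n - 1) / x = - \<Sum>k<n. (H\<^sub>n - H\<^sub>k) L\<^sub>k\<close>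
  (lemma \<open>laguerre_poly_minus_one\<close>).

  Orthonormality (lemma \<open>laguerre_poly_orthonormal\<close>) follows from the first relation as well, together
  with integration by parts, \<open>E (p') = E p - p(0)\<close>. It then remains to see that
  \<open>\<Sum>k<n. (H\<^sub>n - H\<^sub>k)\<^sup>2 = 2 n - H\<^sub>n\<close>, an induction on \<open>n\<close>.
\<close>

section \<open>Integrating polynomials against the exponential weight\<close>

text \<open>The value \<open>\<integral> x\<^sup>i exp (- x) dx = i!\<close>, extended linearly. Defining the functional
  algebraically keeps integrability out of the computations with Laguerre polynomials.\<close>

definition exp_moment :: "real poly \<Rightarrow> real" where
  "exp_moment p = (\<Sum>i\<le>degree p. coeff p i * fact i)"

lemma exp_moment_bounded_degree:
  assumes "degree p \<le> N"
  shows "exp_moment p = (\<Sum>i\<le>N. coeff p i * fact i)"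
  unfolding exp_moment_def
  by (rule sum.mono_neutral_left) (use assms in \<open>auto simp: coeff_eq_0\<close>)

lemma power_exp_has_integral:
  "((\<lambda>x::real. x ^ i * exp (- x)) has_integral fact i) {0<..}"
proof -
  have "((\<lambda>t. t powr (real (Suc i) - 1) / exp t) has_integral Gamma (real (Suc i))) {0..}"
    by (rule Gamma_integral_real) simp
  hence "((\<lambda>t. t powr real i / exp t) has_integral fact i) {0..}"
    by (simp add: Gamma_fact add.commute)
  hence "((\<lambda>t. t powr real i / exp t) has_integral fact i) {0<..}"
    by (rule has_integral_spike_set_eq[THEN iffD1, rotated -1])
       (auto intro: negligible_subset[of "{0::real}"])
  thus ?thesis
    by (rule has_integral_eq[rotated]) (auto simp: powr_realpow exp_minus field_simps)
qed

lemma poly_exp_has_integral: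
  "((\<lambda>x. poly p x * exp (- x)) has_integral exp_moment p) {0<..}"
proof -
  have "((\<lambda>x. \<Sum>i\<le>degree p. coeff p i * (x ^ i * exp (- x))) has_integral exp_moment p) {0<..}"
    unfolding exp_moment_def
    by (intro has_integral_sum has_integral_mult_right power_exp_has_integral) auto
  thus ?thesis
    by (simp add: poly_altdef sum_distrib_right mult.assoc)
qed

lemma exp_moment_add: "exp_moment (p + q) = exp_moment p + exp_moment q"
proof -
  let ?N = "max (degree p) (degree q)"
  show ?thesis
    by (simp add: exp_moment_bounded_degree[of _ ?N] degree_add_le sum.distrib algebra_simps)
qed

lemma exp_moment_smult: "exp_moment (smult c p) = c * exp_moment p"
  by (simp add: exp_moment_bounded_degree[of _ "degree p"] degree_smult_le sum_distrib_left
      mult.assoc)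

lemma exp_moment_0: "exp_moment 0 = 0"
  by (simp add: exp_moment_def)

lemma exp_moment_minus: "exp_moment (- p) = - exp_moment p"
  using exp_moment_smult[of "-1" p] by simp

lemma exp_moment_diff: "exp_moment (p - q) = exp_moment p - exp_moment q"
  using exp_moment_add[of p "- q"] by (simp add: exp_moment_minus)

lemma exp_moment_sum: "exp_moment (\<Sum>k\<in>A. f k) = (\<Sum>k\<in>A. exp_moment (f k))"
  by (induction A rule: infinite_finite_induct) (simp_all add: exp_moment_0 exp_moment_add)

text \<open>Integration by parts; on the monomial \<open>x\<^sup>i\<^sup>+\<^sup>1\<close> it says \<open>(i + 1) i! = (i + 1)!\<close>.\<close>

lemma exp_moment_pderiv: "exp_moment (pderiv p) = exp_moment p - coeff p 0"
proof -
  have "exp_moment p = (\<Sum>i\<le>Suc (degree p). coeff p i * fact i)"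
    by (rule exp_moment_bounded_degree) simp
  also have "\<dots> = coeff p 0 + (\<Sum>i\<le>degree p. coeff p (Suc i) * fact (Suc i))"
    by (subst sum.atMost_Suc_shift) simp
  also have "(\<Sum>i\<le>degree p. coeff p (Suc i) * fact (Suc i)) = exp_moment (pderiv p)"
    by (subst exp_moment_bounded_degree[of _ "degree p"])
       (simp_all add: degree_pderiv coeff_pderiv mult_ac)
  finally show ?thesis by simp
qed

section \<open>Laguerre polynomials\<close>

lemma smult_sum_right: "smult c (\<Sum>k\<in>A. f k) = (\<Sum>k\<in>A. smult c (f k))"
  by (induction A rule: infinite_finite_induct) (simp_all add: smult_add_right)

definition laguerre_poly :: "nat \<Rightarrow> real poly" where
  "laguerre_poly n = (\<Sum>k\<le>n. monom ((-1) ^ k / fact k * real (n choose k)) k)"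

lemma poly_laguerre_poly: "poly (laguerre_poly n) x = laguerre n x"
  by (simp add: laguerre_poly_def laguerre_def poly_sum poly_monom atMost_atLeast0)

lemma coeff_laguerre_poly: "coeff (laguerre_poly n) k = (-1) ^ k / fact k * real (n choose k)"
  by (simp add: laguerre_poly_def coeff_sum if_distrib cong: if_cong)

lemma laguerre_poly_0: "laguerre_poly 0 = 1"
  by (simp add: laguerre_poly_def)

lemma pderiv_laguerre_poly_diff:
  "pderiv (laguerre_poly (Suc n) - laguerre_poly n) = - laguerre_poly n"
  by (rule poly_eqI)
     (simp add: coeff_pderiv coeff_laguerre_poly field_simps del: of_nat_Suc)

lemma pderiv_laguerre_poly: "pderiv (laguerre_poly n) = - (\<Sum>k<n. laguerre_poly k)"
proof (induction n)
  case 0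
  show ?case by (simp add: laguerre_poly_0)
next
  case (Suc n)
  thus ?case using pderiv_laguerre_poly_diff[of n]
    by (simp add: pderiv_diff algebra_simps)
qed

text \<open>The equation \<open>x L\<^sub>n\<^sub>+\<^sub>1' = (n + 1) (L\<^sub>n\<^sub>+\<^sub>1 - L\<^sub>n)\<close>, solved for the difference; on coefficients
  it is the absorption identity for binomial coefficients.\<close>

lemma laguerre_poly_diff:
  "laguerre_poly (Suc n) - laguerre_poly n =
     smult (1 / real (Suc n)) (pCons 0 (pderiv (laguerre_poly (Suc n))))"
proof (rule poly_eqI)
  fix j
  show "coeff (laguerre_poly (Suc n) - laguerre_poly n) j =
    coeff (smult (1 / real (Suc n)) (pCons 0 (pderiv (laguerre_poly (Suc n))))) j"
  proof (cases j)
    case 0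
    thus ?thesis by (simp add: coeff_laguerre_poly)
  next
    case (Suc k)
    have absorb: "real (Suc k) * real (Suc n choose Suc k) = real (Suc n) * real (n choose k)"
      by (metis Suc_times_binomial_eq mult.commute of_nat_mult)
    have "coeff (laguerre_poly (Suc n) - laguerre_poly n) j =
        (-1) ^ Suc k / fact (Suc k) * real (n choose k)"
      by (simp add: Suc coeff_laguerre_poly algebra_simps del: fact_Suc)
    also have "\<dots> = 1 / real (Suc n) *
        ((-1) ^ Suc k / fact (Suc k) * (real (Suc k) * real (Suc n choose Suc k)))"
      unfolding absorb by (simp del: fact_Suc of_nat_Suc)
    also have "\<dots> = coeff (smult (1 / real (Suc n)) (pCons 0 (pderiv (laguerre_poly (Suc n))))) j"
      by (simp add: Suc coeff_pderiv coeff_laguerre_poly del: fact_Suc of_nat_Suc binomial_Suc_Suc)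
    finally show ?thesis .
  qed
qed

text \<open>Passing from \<open>n\<close> to \<open>n + 1\<close> adds \<open>- (L\<^sub>0 + \<dots> + L\<^sub>n) / (n + 1)\<close> to the quotient
  \<open>(L\<^sub>n - 1) / x\<close>; so \<open>L\<^sub>k\<close> has collected \<open>- 1 / m\<close> for every \<open>m\<close> with \<open>k < m \<le> n\<close>.\<close>

lemma laguerre_poly_minus_one:
  "laguerre_poly n - 1 = pCons 0 (- (\<Sum>k<n. smult (harm n - harm k) (laguerre_poly k)))"
proof (induction n)
  case 0
  show ?case by (simp add: laguerre_poly_0)
next
  case (Suc n)
  let ?S = "\<lambda>n. \<Sum>k<n. smult (harm n - harm k) (laguerre_poly k)"
  \<comment> \<open>The new summand \<open>k = n\<close> is the increment alone, since \<open>harm n - harm n = 0\<close>.\<close>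
  have "?S (Suc n) = (\<Sum>k<Suc n. smult (harm n - harm k) (laguerre_poly k)
      + smult (1 / real (Suc n)) (laguerre_poly k))"
    by (intro sum.cong refl)
       (simp add: harm_Suc smult_add_left[symmetric] inverse_eq_divide algebra_simps)
  also have "\<dots> = ?S n + smult (1 / real (Suc n)) (\<Sum>k<Suc n. laguerre_poly k)"
    by (simp only: sum.distrib smult_sum_right) simp
  finally have step: "?S (Suc n) = ?S n + smult (1 / real (Suc n)) (\<Sum>k<Suc n. laguerre_poly k)" .
  have "laguerre_poly (Suc n) - 1 =
      (laguerre_poly n - 1) + (laguerre_poly (Suc n) - laguerre_poly n)"
    by simp
  also have "\<dots> = pCons 0 (- ?S n) +
      smult (1 / real (Suc n)) (pCons 0 (- (\<Sum>k<Suc n. laguerre_poly k)))"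
    by (simp only: Suc.IH laguerre_poly_diff pderiv_laguerre_poly)
  also have "\<dots> = pCons 0 (- ?S (Suc n))"
    unfolding step by (simp del: sum.lessThan_Suc)
  finally show ?case .
qed

lemma exp_moment_laguerre_poly: "exp_moment (laguerre_poly n) = (if n = 0 then 1 else 0)"
proof (cases n)
  case 0
  thus ?thesis by (simp add: laguerre_poly_0 exp_moment_def)
next
  case (Suc m)
  have "exp_moment (- laguerre_poly m) = exp_moment (laguerre_poly n - laguerre_poly m)"
    unfolding Suc pderiv_laguerre_poly_diff[symmetric] exp_moment_pderiv
    by (simp add: coeff_laguerre_poly)
  thus ?thesis using Suc by (simp add: exp_moment_minus exp_moment_diff)
qed

text \<open>With \<open>D\<^sub>n = L\<^sub>n\<^sub>+\<^sub>1 - L\<^sub>n\<close> we have \<open>D\<^sub>n(0) = 0\<close> and \<open>D\<^sub>n' = - L\<^sub>n\<close>, so integrating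
  \<open>D\<^sub>m D\<^sub>n\<close> by parts gives \<open>E (D\<^sub>m D\<^sub>n) = - E (L\<^sub>m D\<^sub>n) - E (D\<^sub>m L\<^sub>n)\<close>, where \<open>E\<close> is
  \<open>exp_moment\<close>. After expansion the mixed terms \<open>L\<^sub>m L\<^sub>n\<^sub>+\<^sub>1\<close> and \<open>L\<^sub>m\<^sub>+\<^sub>1 L\<^sub>n\<close> cancel.\<close>

lemma exp_moment_laguerre_poly_Suc_Suc:
  "exp_moment (laguerre_poly (Suc m) * laguerre_poly (Suc n)) =
   exp_moment (laguerre_poly m * laguerre_poly n)"
proof -
  define D where "D = (\<lambda>n. laguerre_poly (Suc n) - laguerre_poly n)"
  have D': "pderiv (D k) = - laguerre_poly k" for k
    by (simp add: D_def pderiv_laguerre_poly_diff)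
  have "coeff (D m * D n) 0 = 0"
    by (simp add: D_def coeff_mult coeff_laguerre_poly)
  hence "exp_moment (D m * D n) = exp_moment (pderiv (D m * D n))"
    by (simp add: exp_moment_pderiv)
  also have "\<dots> = - exp_moment (D m * laguerre_poly n) - exp_moment (laguerre_poly m * D n)"
    by (simp add: pderiv_mult D' exp_moment_diff exp_moment_minus mult.commute)
  finally show ?thesis
    by (simp add: D_def algebra_simps exp_moment_diff exp_moment_add)
qed

text \<open>Descend along the diagonal until one factor is \<open>L\<^sub>0 = 1\<close>.\<close>

lemma laguerre_poly_orthonormal:
  "exp_moment (laguerre_poly m * laguerre_poly n) = (if m = n then 1 else 0)"
proof (induction m arbitrary: n)
  case 0
  show ?case by (simp add: laguerre_poly_0 exp_moment_laguerre_poly)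
next
  case (Suc m)
  show ?case
  proof (cases n)
    case 0
    thus ?thesis by (simp add: laguerre_poly_0 exp_moment_laguerre_poly)
  next
    case (Suc k)
    thus ?thesis by (simp add: exp_moment_laguerre_poly_Suc_Suc Suc.IH)
  qed
qed

lemma exp_moment_laguerre_expansion_square:
  "exp_moment ((\<Sum>k<n. smult (c k) (laguerre_poly k))\<^sup>2) = (\<Sum>k<n. (c k)\<^sup>2)"
proof -
  have "exp_moment ((\<Sum>k<n. smult (c k) (laguerre_poly k))\<^sup>2) =
      (\<Sum>k<n. \<Sum>j<n. c k * (c j * (if k = j then 1 else 0)))"
    by (simp add: power2_eq_square sum_product exp_moment_sum exp_moment_smult
        laguerre_poly_orthonormal mult_ac cong: if_cong)
  also have "\<dots> = (\<Sum>k<n. (c k)\<^sup>2)"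
    by (simp add: if_distrib power2_eq_square cong: if_cong)
  finally show ?thesis .
qed

section \<open>Sums of harmonic differences\<close>

lemma sum_harm_diff: "(\<Sum>k<n. harm n - harm k :: real) = real n"
proof (induction n)
  case (Suc n)
  have "(\<Sum>k<Suc n. harm (Suc n) - harm k :: real) =
      (\<Sum>k<Suc n. (harm n - harm k) + inverse (real (Suc n)))"
    by (simp add: harm_Suc algebra_simps)
  also have "\<dots> = (\<Sum>k<n. harm n - harm k) + real (Suc n) * inverse (real (Suc n))"
    by (simp only: sum.distrib) simp
  finally show ?case using Suc by simp
qed simp

text \<open>Raising \<open>n\<close> by one shifts each of the \<open>n + 1\<close> differences by \<open>1 / (n + 1)\<close>, which adds
  \<open>2 / (n + 1)\<close> times their sum \<open>n\<close>, and \<open>(n + 1) / (n + 1)\<^sup>2\<close>: in total \<open>2 - 1 / (n + 1)\<close>.\<close>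

lemma sum_harm_diff_squared: "(\<Sum>k<n. (harm n - harm k :: real)\<^sup>2) = 2 * real n - harm n"
proof (induction n)
  case 0
  show ?case by (simp add: harm_def)
next
  case (Suc n)
  define r where "r = inverse (real (Suc n))"
  have r: "real (Suc n) * r = 1" by (simp add: r_def)
  have harm_Suc_r: "harm (Suc n) = harm n + r" by (simp only: r_def harm_Suc)
  have "(\<Sum>k<Suc n. (harm (Suc n) - harm k :: real)\<^sup>2) =
      (\<Sum>k<Suc n. (harm n - harm k)\<^sup>2 + 2 * r * (harm n - harm k) + r\<^sup>2)"
    by (intro sum.cong refl) (simp add: harm_Suc_r power2_eq_square algebra_simps)
  also have "\<dots> = (\<Sum>k<n. (harm n - harm k)\<^sup>2) + 2 * r * (\<Sum>k<n. harm n - harm k)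
      + real (Suc n) * r\<^sup>2"
    by (simp only: sum.distrib sum_distrib_left[symmetric]) simp
  also have "\<dots> = 2 * real n - harm n + 2 * r * real n + real (Suc n) * r * r"
    unfolding Suc.IH sum_harm_diff by (simp only: power2_eq_square mult.assoc)
  also have "\<dots> = 2 * real n - harm n + 2 * (real (Suc n) * r) - r"
  proof -
    have "r * real n = 1 - r" using r by (simp add: algebra_simps)
    thus ?thesis unfolding r by simp
  qed
  also have "\<dots> = 2 * real (Suc n) - harm (Suc n)"
    by (simp add: r harm_Suc_r del: of_nat_Suc) simp
  finally show ?case .
qed

section \<open>The integral\<close>

theorem theorem1p5:
  fixes n :: nat
  assumes "n \<ge> 1"
  shows "((\<lambda>x::real. ((laguerre n x - laguerre n 0) / x)\<^sup>2 * exp (- x))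
           has_integral (2 * real n - harm n)) {0<..}"
proof -
  define Q where "Q = (\<Sum>k<n. smult (harm n - harm k) (laguerre_poly k))"
  have expansion: "laguerre n x = 1 - x * poly Q x" for x
    using arg_cong[OF laguerre_poly_minus_one[of n], of "\<lambda>p. poly p x"]
    by (simp add: poly_laguerre_poly Q_def algebra_simps)
  have quotient: "(laguerre n x - laguerre n 0) / x = - poly Q x" if "x > 0" for x
    using that by (simp add: expansion[of x] expansion[of 0])
  have "((\<lambda>x. poly (Q\<^sup>2) x * exp (- x)) has_integral (2 * real n - harm n)) {0<..}"
    using poly_exp_has_integral[of "Q\<^sup>2"]
    by (simp add: Q_def exp_moment_laguerre_expansion_square sum_harm_diff_squared)
  thus ?thesis
    by (rule has_integral_eq[rotated]) (simp add: quotient)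
qed

end
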